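(* There is a deterministic multi-pass streaming algorithm which, given an integer $k \ge 1$ and an $n$-vertex undirected graph $G$ whose edges arrive as an insertion-only stream (in the same order in every pass), makes at most $2^{k}$ passes over the stream, stores $O(k\log n)$ bits, and correctly outputs a vertex cover of $G$ of size at most $k$ if one exists, and outputs NO otherwise.
   Context: Streaming model: the vertex set $V$ of $G$ (with $|V|=n$) is fixed and known; the edges of $G$ are presented one by one in a stream (insertion-only: edges are only inserted). In a multi-pass algorithm the stream is read several times, each time in the same order. The algorithm may perform unbounded computation; its space is the number of bits it stores. A vertex cover of $G$ is a set $S\subseteq V$ containing at least one endpoint of every edge. *)

theory Defs
  imports Complex_Main
begin

section \<open>Multi-pass streaming algorithms\<close>

type_synonym memory = "bool list"

datatype 'o pass_end = Halt 'o | Next_Pass memory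

text \<open>
  The memory is the only information carried from one stream item to the next and from one
  pass to the next. The maps are arbitrary functions (computation is unbounded), but they do not
  see the position in the stream or the index of the current pass: an algorithm that needs
  these has to keep them in memory.
\<close>

record ('i, 'o) streaming_alg =
  init_mem :: memory
  on_item :: "memory \<Rightarrow> 'i \<Rightarrow> memory"
  on_pass_end :: "memory \<Rightarrow> 'o pass_end"

definition scan :: "('i, 'o) streaming_alg \<Rightarrow> memory \<Rightarrow> 'i list \<Rightarrow> memory" where
  "scan A m xs = foldl (on_item A) m xs"

text \<open>
  \<open>halts_from A xs m p out\<close>: started in memory \<open>m\<close> at the beginning of the stream \<open>xs\<close>,
  the algorithm makes exactly \<open>p\<close> passes and then halts with output \<open>out\<close>.
\<close>

inductive halts_from ::
  "('i, 'o) streaming_alg \<Rightarrow> 'i list \<Rightarrow> memory \<Rightarrow> nat \<Rightarrow> 'o \<Rightarrow> bool"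
  for A :: "('i, 'o) streaming_alg" and xs :: "'i list" where
  halt: "on_pass_end A (scan A m xs) = Halt out \<Longrightarrow> halts_from A xs m 1 out"
| next_pass: "\<lbrakk>on_pass_end A (scan A m xs) = Next_Pass m'; halts_from A xs m' p out\<rbrakk>
    \<Longrightarrow> halts_from A xs m (Suc p) out"

definition runs_to :: "('i, 'o) streaming_alg \<Rightarrow> 'i list \<Rightarrow> nat \<Rightarrow> 'o \<Rightarrow> bool" where
  "runs_to A xs p out \<longleftrightarrow> halts_from A xs (init_mem A) p out"

inductive_set pass_starts :: "('i, 'o) streaming_alg \<Rightarrow> 'i list \<Rightarrow> memory set"
  for A :: "('i, 'o) streaming_alg" and xs :: "'i list" where
  first: "init_mem A \<in> pass_starts A xs"
| later: "\<lbrakk>m \<in> pass_starts A xs; on_pass_end A (scan A m xs) = Next_Pass m'\<rbrakk>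
    \<Longrightarrow> m' \<in> pass_starts A xs"

text \<open>All memory contents that occur at any time while \<open>A\<close> runs on the stream \<open>xs\<close>.\<close>

definition memories :: "('i, 'o) streaming_alg \<Rightarrow> 'i list \<Rightarrow> memory set" where
  "memories A xs = {scan A m (take i xs) | m i. m \<in> pass_starts A xs \<and> i \<le> length xs}"

section \<open>Graphs, edge streams and vertex covers\<close>

definition graph :: "'v set \<Rightarrow> 'v set set \<Rightarrow> bool" where
  "graph V E \<longleftrightarrow> finite V \<and> (\<forall>e\<in>E. e \<subseteq> V \<and> card e = 2)"

definition edge_stream :: "'v set set \<Rightarrow> 'v set list \<Rightarrow> bool" where
  "edge_stream E es \<longleftrightarrow> distinct es \<and> set es = E"

definition vertex_cover :: "'v set \<Rightarrow> 'v set set \<Rightarrow> 'v set \<Rightarrow> bool" where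
  "vertex_cover V E S \<longleftrightarrow> S \<subseteq> V \<and> (\<forall>e\<in>E. e \<inter> S \<noteq> {})"

text \<open>\<open>None\<close> is the answer NO.\<close>

definition correct_vc_answer :: "'v set \<Rightarrow> 'v set set \<Rightarrow> nat \<Rightarrow> 'v set option \<Rightarrow> bool" where
  "correct_vc_answer V E k out \<longleftrightarrow>
     (if \<exists>S. vertex_cover V E S \<and> card S \<le> k
      then \<exists>S. out = Some S \<and> vertex_cover V E S \<and> card S \<le> k
      else out = None)"

end

theory Submission
  imports Defs
begin

text \<open>
  A pass is driven by a string of \<open>k\<close> bits: it grows a partial cover, and the \<open>i\<close>-th time it
  meets an uncovered edge it adds the endpoint selected by the \<open>i\<close>-th bit; it fails on an
  uncovered edge once \<open>k\<close> vertices have been chosen. If a cover \<open>S\<close> of size at most \<open>k\<close> exists, the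
  string that always selects an endpoint in \<open>S\<close> makes the pass succeed, because the
  chosen vertices are distinct elements of \<open>S\<close>. So it suffices to try the
  \<open>2\<^sup>k\<close> strings, one per pass. The string and the partial cover together take at most
  \<open>2\<^sup>k \<cdot> 2(n+1)\<^sup>k\<close> values.
\<close>

section \<open>Realising a finite-state algorithm with a bit memory\<close>

text \<open>\<open>enc\<close> and \<open>dec\<close> are unrelated here. The lemmas below ask
  \<open>dec\<close> to invert \<open>enc\<close> only on a set \<open>X\<close> of states closed
  under the transitions, so an encoding injective on \<open>X\<close> suffices.\<close>

definition encoded_alg ::
  "('s \<Rightarrow> memory) \<Rightarrow> (memory \<Rightarrow> 's) \<Rightarrow> 's \<Rightarrow> ('s \<Rightarrow> 'i \<Rightarrow> 's) \<Rightarrow> ('s \<Rightarrow> 'o + 's) \<Rightarrow>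
     ('i, 'o) streaming_alg" where
  "encoded_alg enc dec s0 step fin =
     \<lparr>init_mem = enc s0,
      on_item = \<lambda>m x. enc (step (dec m) x),
      on_pass_end = \<lambda>m. case fin (dec m) of Inl out \<Rightarrow> Halt out | Inr s \<Rightarrow> Next_Pass (enc s)\<rparr>"

lemma foldl_closed:
  assumes "s \<in> X" and "\<And>s x. s \<in> X \<Longrightarrow> x \<in> set xs \<Longrightarrow> step s x \<in> X"
  shows "foldl step s xs \<in> X"
  using assms by (induction xs arbitrary: s) auto

lemma scan_encoded_alg:
  assumes "s \<in> X" and "\<And>s x. s \<in> X \<Longrightarrow> x \<in> set xs \<Longrightarrow> step s x \<in> X"
    and "\<And>s. s \<in> X \<Longrightarrow> dec (enc s) = s"
  shows "scan (encoded_alg enc dec s0 step fin) (enc s) xs = enc (foldl step s xs)"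
  using assms unfolding scan_def
  by (induction xs arbitrary: s) (auto simp: encoded_alg_def)

text \<open>Reduces the space bound to the length of codes of states in \<open>X\<close>.
  Interrupted passes are covered because the items of a prefix are items of the stream.\<close>

lemma memories_encoded_alg:
  assumes s0: "s0 \<in> X" and step: "\<And>s x. s \<in> X \<Longrightarrow> x \<in> set xs \<Longrightarrow> step s x \<in> X"
    and fin: "\<And>s s'. s \<in> X \<Longrightarrow> fin s = Inr s' \<Longrightarrow> s' \<in> X"
    and dec: "\<And>s. s \<in> X \<Longrightarrow> dec (enc s) = s"
  shows "memories (encoded_alg enc dec s0 step fin) xs \<subseteq> enc ` X"
proof -
  let ?A = "encoded_alg enc dec s0 step fin"
  have starts: "m \<in> enc ` X" if "m \<in> pass_starts ?A xs" for m
    using that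
  proof induction
    case first
    then show ?case using s0 by (simp add: encoded_alg_def)
  next
    case (later m m')
    then obtain s where s: "s \<in> X" "m = enc s" by auto
    have "foldl step s xs \<in> X" using s step by (intro foldl_closed)
    moreover have "scan ?A m xs = enc (foldl step s xs)"
      unfolding s(2) by (rule scan_encoded_alg[where X = X]) (use s step dec in auto)
    ultimately show ?case
      using later.hyps(2) fin dec by (auto simp: encoded_alg_def split: sum.splits)
  qed
  show ?thesis
  proof
    fix m assume "m \<in> memories ?A xs"
    then obtain s i where s: "s \<in> X" "m = scan ?A (enc s) (take i xs)"
      using starts unfolding memories_def by blast
    have step': "\<And>s x. s \<in> X \<Longrightarrow> x \<in> set (take i xs) \<Longrightarrow> step s x \<in> X"
      using step by (auto dest: in_set_takeD)
    have "m = enc (foldl step s (take i xs))"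
      using s step' dec by (simp add: scan_encoded_alg[of s X])
    moreover have "foldl step s (take i xs) \<in> X"
      using s step' by (intro foldl_closed)
    ultimately show "m \<in> enc ` X" by blast
  qed
qed

text \<open>There are exactly \<open>2 ^ L\<close> bit lists of length \<open>L\<close>, so a
  cardinality comparison yields an injection into them.\<close>

lemma ex_bit_encoding:
  assumes "finite X" and "card X \<le> 2 ^ L"
  shows "\<exists>enc :: 's \<Rightarrow> bool list. inj_on enc X \<and> (\<forall>s\<in>X. length (enc s) = L)"
proof -
  let ?Y = "{bs :: bool list. set bs \<subseteq> UNIV \<and> length bs = L}"
  have "card ?Y = 2 ^ L" "finite ?Y"
    using card_lists_length_eq[of "UNIV :: bool set" L] finite_lists_length_eq[of "UNIV :: bool set" L]
    by simp_all
  then obtain enc where "inj_on enc X" "enc ` X \<subseteq> ?Y"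
    using assms card_le_inj[of X ?Y] by auto
  then show ?thesis by auto
qed

section \<open>One pass\<close>

text \<open>Edges are unordered sets, so a choice operator has to name a first and a second
  endpoint. The naming depends on the edge alone, so it is the same in every pass.\<close>

definition endpoint :: "bool \<Rightarrow> 'v set \<Rightarrow> 'v" where
  "endpoint b e = (let u = SOME v. v \<in> e in if b then u else SOME v. v \<in> e - {u})"

lemma endpoints:
  assumes "card e = 2"
  shows "e = {endpoint True e, endpoint False e}"
proof -
  let ?u = "endpoint True e"
  have "e \<noteq> {}" using assms by auto
  then have u: "?u \<in> e" by (simp add: endpoint_def some_in_eq)
  have "card (e - {?u}) = 1" using u assms by simp
  then obtain v where v: "e - {?u} = {v}" by (auto simp: card_1_singleton_iff)
  have "endpoint False e = (SOME w. w \<in> e - {?u})" by (simp add: endpoint_def)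
  also have "\<dots> = v" unfolding v by simp
  finally show ?thesis using u v by auto
qed

lemma endpoint_in: "card e = 2 \<Longrightarrow> endpoint b e \<in> e"
  using endpoints[of e] by (cases b) auto

text \<open>\<open>None\<close> records that an uncovered edge was met after \<open>k\<close> vertices had been chosen.\<close>

fun grow :: "nat \<Rightarrow> (nat \<Rightarrow> bool) \<Rightarrow> 'v list option \<Rightarrow> 'v set \<Rightarrow> 'v list option" where
  "grow k \<beta> None e = None"
| "grow k \<beta> (Some c) e =
    (if e \<inter> set c \<noteq> {} then Some c
     else if length c < k then Some (c @ [endpoint (\<beta> (length c)) e]) else None)"

definition partial_covers :: "nat \<Rightarrow> 'v set \<Rightarrow> 'v list set" where
  "partial_covers k V = {c. set c \<subseteq> V \<and> length c \<le> k}"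

lemma grow_closed:
  assumes "c \<in> insert None (Some ` partial_covers k V)" and "e \<subseteq> V" and "card e = 2"
  shows "grow k \<beta> c e \<in> insert None (Some ` partial_covers k V)"
proof (cases c)
  case (Some d)
  then have "set d \<subseteq> V" "length d \<le> k" using assms(1) by (auto simp: partial_covers_def)
  moreover have "endpoint (\<beta> (length d)) e \<in> V" using endpoint_in[OF assms(3)] assms(2) by blast
  ultimately show ?thesis using Some by (simp add: partial_covers_def image_iff)
qed simp

lemma foldl_grow_None [simp]: "foldl (grow k \<beta>) None es = None"
  by (induction es) auto

text \<open>Chosen vertices are never dropped, so an edge that is covered once it has been read
  stays covered to the end of the pass.\<close>

lemma foldl_grow_covers:
  assumes "foldl (grow k \<beta>) (Some c) es = Some c'" and "\<And>e. e \<in> set es \<Longrightarrow> card e = 2"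
  shows "set c \<subseteq> set c' \<and> (\<forall>e\<in>set es. e \<inter> set c' \<noteq> {})"
  using assms
proof (induction es arbitrary: c)
  case Nil
  then show ?case by simp
next
  case (Cons e es)
  obtain d where d: "grow k \<beta> (Some c) e = Some d"
    using Cons.prems(1) by (cases "grow k \<beta> (Some c) e") (auto simp del: grow.simps)
  have "set d \<subseteq> set c' \<and> (\<forall>e\<in>set es. e \<inter> set c' \<noteq> {})"
    using Cons d by (simp del: grow.simps)
  moreover have "set c \<subseteq> set d \<and> e \<inter> set d \<noteq> {}"
    using d endpoint_in[of e] Cons.prems(2)[of e] by (auto split: if_splits)
  ultimately show ?case by auto
qed

text \<open>A pass reads \<open>\<beta>\<close> only at the current length of the list, which starts
  at \<open>length c\<close>, never decreases and is below \<open>k\<close> whenever a bit is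
  read.\<close>

lemma foldl_grow_cong:
  assumes "\<And>i. length c \<le> i \<Longrightarrow> i < k \<Longrightarrow> \<beta> i = \<beta>' i"
  shows "foldl (grow k \<beta>) (Some c) es = foldl (grow k \<beta>') (Some c) es"
  using assms
proof (induction es arbitrary: c)
  case (Cons e es)
  have "foldl (grow k \<beta>) (Some (c @ [v])) es = foldl (grow k \<beta>') (Some (c @ [v])) es" for v
    using Cons.prems by (intro Cons.IH) simp
  then show ?case using Cons by simp
qed simp

text \<open>The start \<open>c\<close> is general so that induction on the stream applies. At an
  uncovered edge, an endpoint in \<open>S\<close> lies outside \<open>c\<close>, hence
  \<open>length c < card S \<le> k\<close> and the list still has room for it.\<close>

lemma ex_successful_choices:
  assumes "finite S" and "card S \<le> k" and "set c \<subseteq> S" and "distinct c"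
    and "\<And>e. e \<in> set es \<Longrightarrow> card e = 2 \<and> e \<inter> S \<noteq> {}"
  shows "\<exists>\<beta>. foldl (grow k \<beta>) (Some c) es \<noteq> None"
  using assms(3-)
proof (induction es arbitrary: c)
  case Nil
  then show ?case by simp
next
  case (Cons e es)
  show ?case
  proof (cases "e \<inter> set c = {}")
    case False
    then show ?thesis using Cons.IH[of c] Cons.prems by simp
  next
    case True
    obtain v where v: "v \<in> e" "v \<in> S" using Cons.prems(3)[of e] by auto
    have "e = {endpoint True e, endpoint False e}" using Cons.prems(3) by (simp add: endpoints)
    then have "v = endpoint True e \<or> v = endpoint False e" using v(1) by blast
    then obtain b where b: "endpoint b e = v" by metis
    have "v \<notin> set c" using True v by auto
    then have "set c \<subset> S" using v Cons.prems(1) by auto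
    then have "card (set c) < card S" by (rule psubset_card_mono[OF assms(1)])
    then have "length c < k" using distinct_card[OF Cons.prems(2)] assms(2) by linarith
    obtain \<beta> where \<beta>: "foldl (grow k \<beta>) (Some (c @ [v])) es \<noteq> None"
      using Cons.IH[of "c @ [v]"] Cons.prems v \<open>v \<notin> set c\<close> by auto
    \<comment> \<open>The induction hypothesis supplies the later choices. Overwriting position
      \<open>length c\<close> does not disturb them, as the rest of the pass starts from a list of
      length \<open>length c + 1\<close>.\<close>
    let ?\<beta> = "\<beta>(length c := b)"
    have "foldl (grow k ?\<beta>) (Some c) (e # es) = foldl (grow k ?\<beta>) (Some (c @ [v])) es"
      using True \<open>length c < k\<close> b by simp
    also have "\<dots> = foldl (grow k \<beta>) (Some (c @ [v])) es"
      by (rule foldl_grow_cong) auto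
    finally show ?thesis using \<beta> by metis
  qed
qed

text \<open>Lets a pass counter serve as the choice string: counting from 0 to
  \<open>2 ^ k - 1\<close> runs through all strings of \<open>k\<close> bits.\<close>

lemma ex_nat_with_bits: "\<exists>t::nat. t < 2 ^ k \<and> (\<forall>i<k. bit t i = \<beta> i)"
proof -
  let ?t = "horner_sum of_bool 2 (map \<beta> [0..<k]) :: nat"
  have "\<forall>i. bit ?t i \<longleftrightarrow> i < k \<and> \<beta> i" by (auto simp: bit_horner_sum_bit_iff)
  \<comment> \<open>All bits from position \<open>k\<close> on vanish, so truncation to
    \<open>k\<close> bits changes nothing; this is equivalent to \<open>?t < 2 ^ k\<close>.\<close>
  moreover from this have "take_bit k ?t = ?t"
    by (intro bit_eqI) (auto simp: bit_take_bit_iff)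
  then have "?t < 2 ^ k" by (simp add: take_bit_nat_eq_self_iff)
  ultimately show ?thesis by blast
qed

section \<open>The vertex cover algorithm\<close>

text \<open>A state \<open>(t, c)\<close> holds the bit string as the number \<open>t\<close> it represents, and the partial cover.\<close>

definition vc_step :: "nat \<Rightarrow> nat \<times> 'v list option \<Rightarrow> 'v set \<Rightarrow> nat \<times> 'v list option" where
  "vc_step k s e = (fst s, grow k (bit (fst s)) (snd s) e)"

text \<open>The test is made on the successor, so the counter never reaches \<open>2 ^ k\<close> and
  \<open>k\<close> bits suffice for it.\<close>

definition vc_finish :: "nat \<Rightarrow> nat \<times> 'v list option \<Rightarrow> 'v set option + nat \<times> 'v list option" where
  "vc_finish k s = (case snd s of Some c \<Rightarrow> Inl (Some (set c))
     | None \<Rightarrow> if Suc (fst s) < 2 ^ k then Inr (Suc (fst s), Some []) else Inl None)"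

definition vc_states :: "nat \<Rightarrow> 'v set \<Rightarrow> (nat \<times> 'v list option) set" where
  "vc_states k V = {..<2 ^ k} \<times> insert None (Some ` partial_covers k V)"

abbreviation vc_pass :: "nat \<Rightarrow> 'v set list \<Rightarrow> nat \<Rightarrow> 'v list option" where
  "vc_pass k es t \<equiv> foldl (grow k (bit t)) (Some []) es"

lemma start_in_vc_states: "t < 2 ^ k \<Longrightarrow> (t, Some []) \<in> vc_states k V"
  by (simp add: vc_states_def partial_covers_def)

lemma vc_step_closed:
  "\<lbrakk>s \<in> vc_states k V; e \<subseteq> V; card e = 2\<rbrakk> \<Longrightarrow> vc_step k s e \<in> vc_states k V"
  using grow_closed[of "snd s" k V e "bit (fst s)"]
  by (simp add: vc_states_def vc_step_def mem_Times_iff del: insert_iff)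

lemma vc_finish_closed:
  "vc_finish k s = Inr s' \<Longrightarrow> s' \<in> vc_states k V"
  by (auto simp: vc_finish_def vc_states_def partial_covers_def split: option.splits if_splits)

lemma foldl_vc_step: "foldl (vc_step k) (t, c) es = (t, foldl (grow k (bit t)) c es)"
  by (induction es arbitrary: c) (auto simp: vc_step_def)

section \<open>Number of states and length of their codes\<close>

lemma sum_powers_le: "(\<Sum>i\<le>k. n ^ i) \<le> Suc n ^ k" for n :: nat
proof (induction k)
  case (Suc k)
  have "n * n ^ k \<le> n * Suc n ^ k" by (intro mult_le_mono power_mono) auto
  then show ?case using add_mono[OF Suc] by simp
qed simp

text \<open>Partial covers are lists of length at most \<open>k\<close> over \<open>V\<close>; the
  factor 2 absorbs the additional value \<open>None\<close>.\<close>

lemma card_vc_states: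
  assumes "finite V"
  shows "finite (vc_states k V)" and "card (vc_states k V) \<le> 2 ^ k * (2 * Suc (card V) ^ k)"
proof -
  have fin: "finite (partial_covers k V)"
    unfolding partial_covers_def using assms by (rule finite_lists_length_le)
  then show "finite (vc_states k V)" by (simp add: vc_states_def)
  have "card (partial_covers k V) \<le> Suc (card V) ^ k"
    unfolding partial_covers_def card_lists_length_le[OF assms] by (rule sum_powers_le)
  moreover have "card (insert None (Some ` partial_covers k V)) = Suc (card (partial_covers k V))"
    using fin by (subst card_insert_disjoint) (auto simp: card_image)
  moreover have "1 \<le> Suc (card V) ^ k" by simp
  ultimately have "card (insert None (Some ` partial_covers k V)) \<le> 2 * Suc (card V) ^ k"
    by linarith
  then show "card (vc_states k V) \<le> 2 ^ k * (2 * Suc (card V) ^ k)"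
    unfolding vc_states_def card_cartesian_product by simp
qed

lemma ex_vc_encoding:
  fixes V :: "'v set"
  assumes "finite V" and "2 \<le> card V" and "1 \<le> k"
  shows "\<exists>enc :: nat \<times> 'v list option \<Rightarrow> memory. inj_on enc (vc_states k V) \<and>
    (\<forall>s\<in>vc_states k V. real (length (enc s)) \<le> 5 * real k * log 2 (real (card V)))"
proof -
  let ?n = "card V"
  define l where "l = log 2 (real ?n)"
  define b where "b = nat \<lceil>2 * l\<rceil>"
  have l1: "1 \<le> l" using assms(2) by (simp add: l_def)
  \<comment> \<open>Rounding up adds less than 1, and \<open>1 \<le> l\<close> because there are at
    least two vertices.\<close>
  have b: "2 * l \<le> real b" "real b \<le> 3 * l" using l1 unfolding b_def by linarith+
  \<comment> \<open>Replacing \<open>n + 1\<close> by \<open>n ^ 2\<close>, valid for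
    \<open>n \<ge> 2\<close>, turns the bound into a power of 2 with exponent
    \<open>2 * l\<close>.\<close>
  have "Suc ?n \<le> ?n ^ 2"
    using mult_le_mono1[OF assms(2), of ?n] assms(2) unfolding power2_eq_square by linarith
  then have "real (Suc ?n) \<le> real ?n ^ 2"
    by (metis of_nat_le_iff of_nat_power)
  also have "\<dots> = 2 powr (2 * l)"
    using assms(2) by (simp add: l_def log_def powr_def power2_eq_square exp_double)
  also have "\<dots> \<le> 2 powr real b" using b by simp
  also have "\<dots> = real (2 ^ b)" by (simp add: powr_realpow)
  finally have "Suc ?n \<le> 2 ^ b" by (simp only: of_nat_le_iff)
  then have "Suc ?n ^ k \<le> 2 ^ (b * k)" by (simp add: power_mono power_mult)
  then have "2 ^ k * (2 * Suc ?n ^ k) \<le> 2 ^ k * (2 * 2 ^ (b * k))" by simp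
  also have "\<dots> = 2 ^ (k + (1 + b * k))" by (simp add: power_add)
  finally have "card (vc_states k V) \<le> 2 ^ (k + (1 + b * k))"
    using card_vc_states(2)[OF assms(1), of k] by linarith
  then obtain enc :: "nat \<times> 'v list option \<Rightarrow> memory"
    where enc: "inj_on enc (vc_states k V)" "\<forall>s\<in>vc_states k V. length (enc s) = k + (1 + b * k)"
    using ex_bit_encoding[OF card_vc_states(1)[OF assms(1)]] by blast
  \<comment> \<open>The constant 5 splits as 1 + 1 + 3: one \<open>k * l\<close> bounds the summand
    \<open>k\<close>, one the summand 1, and three bound \<open>b * k\<close>.\<close>
  have "real k \<le> real k * l" using l1 assms(3) by simp
  moreover have "real b * real k \<le> 3 * l * real k" using b by (simp add: mult_right_mono)
  moreover have "1 \<le> real k" using assms(3) by simp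
  moreover have "5 * real k * l = real k * l + real k * l + 3 * l * real k" by simp
  moreover have "real (k + (1 + b * k)) = real k + (1 + real b * real k)" by simp
  ultimately have "real (k + (1 + b * k)) \<le> 5 * real k * l" by linarith
  then show ?thesis using enc unfolding l_def by auto
qed

section \<open>The succession of passes\<close>

lemma halts_from_vc:
  fixes enc :: "nat \<times> 'v list option \<Rightarrow> memory" and dec k
  defines "A \<equiv> encoded_alg enc dec (0, Some []) (vc_step k) (vc_finish k)"
  assumes dec: "\<And>s. s \<in> vc_states k V \<Longrightarrow> dec (enc s) = s"
    and es: "\<And>e. e \<in> set es \<Longrightarrow> e \<subseteq> V \<and> card e = 2"
    and "t < 2 ^ k"
  shows "\<exists>p out. halts_from A es (enc (t, Some [])) p out \<and> p \<le> 2 ^ k - t \<and>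
    ((\<exists>u c. vc_pass k es u = Some c \<and> out = Some (set c)) \<or>
     (out = None \<and> (\<forall>u. t \<le> u \<longrightarrow> u < 2 ^ k \<longrightarrow> vc_pass k es u = None)))"
  using \<open>t < 2 ^ k\<close>
\<comment> \<open>Induction on the number of strings still to be tried, which also bounds the number
  of passes.\<close>
proof (induction "2 ^ k - t" arbitrary: t rule: less_induct)
  case less
  let ?X = "vc_states k V"
  have start: "(t, Some []) \<in> ?X" using less.prems by (rule start_in_vc_states)
  have step: "\<And>s e. s \<in> ?X \<Longrightarrow> e \<in> set es \<Longrightarrow> vc_step k s e \<in> ?X"
    using es vc_step_closed by blast
  have scan: "scan A (enc (t, Some [])) es = enc (t, vc_pass k es t)"
    unfolding A_def
    by (subst scan_encoded_alg[where X = ?X]) (use start step dec in \<open>auto simp: foldl_vc_step\<close>)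
  \<comment> \<open>The state at the end of the pass must lie in \<open>?X\<close>, since
    \<open>dec\<close> is known to invert \<open>enc\<close> only there.\<close>
  have "foldl (vc_step k) (t, Some []) es \<in> ?X"
    using start step by (rule foldl_closed)
  then have "dec (enc (t, vc_pass k es t)) = (t, vc_pass k es t)"
    by (intro dec) (simp add: foldl_vc_step)
  then have pass_end: "on_pass_end A (scan A (enc (t, Some [])) es) =
      (case vc_finish k (t, vc_pass k es t) of Inl out \<Rightarrow> Halt out | Inr s \<Rightarrow> Next_Pass (enc s))"
    unfolding scan by (simp add: A_def encoded_alg_def)
  have pos: "1 \<le> 2 ^ k - t" using less.prems by simp
  show ?case
  proof (cases "vc_pass k es t")
    case (Some c)
    then have "halts_from A es (enc (t, Some [])) 1 (Some (set c))"
      by (intro halt) (simp add: pass_end vc_finish_def)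
    then show ?thesis using pos Some by blast
  next
    case None
    show ?thesis
    proof (cases "Suc t < 2 ^ k")
      case False
      then have "halts_from A es (enc (t, Some [])) 1 None"
        using None by (intro halt) (simp add: pass_end vc_finish_def)
      \<comment> \<open>Here \<open>t\<close> is the last string, so its failure alone justifies the
        answer NO for the range from \<open>t\<close> on.\<close>
      moreover have "u = t" if "t \<le> u" "u < 2 ^ k" for u using False that by linarith
      ultimately show ?thesis using pos None by blast
    next
      case True
      have next_end: "on_pass_end A (scan A (enc (t, Some [])) es) =
          Next_Pass (enc (Suc t, Some []))"
        using None True by (simp add: pass_end vc_finish_def)
      have "2 ^ k - Suc t < 2 ^ k - t" using True by linarith
      then obtain p out where p: "halts_from A es (enc (Suc t, Some [])) p out"
        "p \<le> 2 ^ k - Suc t"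
        and out: "(\<exists>u c. vc_pass k es u = Some c \<and> out = Some (set c)) \<or>
          (out = None \<and> (\<forall>u. Suc t \<le> u \<longrightarrow> u < 2 ^ k \<longrightarrow> vc_pass k es u = None))"
        using less.hyps[of "Suc t"] True by blast
      have "halts_from A es (enc (t, Some [])) (Suc p) out"
        using next_end p(1) by (rule next_pass)
      moreover have "Suc p \<le> 2 ^ k - t" using p(2) True by linarith
      moreover have "(\<exists>u c. vc_pass k es u = Some c \<and> out = Some (set c)) \<or>
          (out = None \<and> (\<forall>u. t \<le> u \<longrightarrow> u < 2 ^ k \<longrightarrow> vc_pass k es u = None))"
        using out None by (metis le_antisym not_less_eq_eq)
      ultimately show ?thesis by blast
    qed
  qed
qed

section \<open>Correctness of the answer and assembly of the algorithm\<close>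

lemma vc_pass_sound:
  assumes "vc_pass k es t = Some c" and es: "\<And>e. e \<in> set es \<Longrightarrow> e \<subseteq> V \<and> card e = 2"
  shows "vertex_cover V (set es) (set c) \<and> card (set c) \<le> k"
proof -
  let ?X = "insert None (Some ` partial_covers k V)"
  have "vc_pass k es t \<in> ?X"
  proof (rule foldl_closed)
    show "Some [] \<in> ?X" by (simp add: partial_covers_def)
    show "grow k (bit t) c e \<in> ?X" if "c \<in> ?X" "e \<in> set es" for c e
      using that es by (intro grow_closed) auto
  qed
  then have "set c \<subseteq> V" "length c \<le> k" using assms(1) by (auto simp: partial_covers_def)
  moreover have "\<forall>e\<in>set es. e \<inter> set c \<noteq> {}"
    using foldl_grow_covers[OF assms(1)] es by blast
  ultimately show ?thesis
    using card_length[of c] by (auto simp: vertex_cover_def)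
qed

text \<open>A pass reads only the first \<open>k\<close> choices, so a successful choice function
  may be replaced by the bits of a number below \<open>2 ^ k\<close>.\<close>

lemma vc_pass_complete:
  assumes "finite V" and "vertex_cover V (set es) S" and "card S \<le> k"
    and "\<And>e. e \<in> set es \<Longrightarrow> card e = 2"
  shows "\<exists>t<2 ^ k. vc_pass k es t \<noteq> None"
proof -
  have "finite S" using assms(1,2) by (auto simp: vertex_cover_def intro: finite_subset)
  then obtain \<beta> where \<beta>: "foldl (grow k \<beta>) (Some []) es \<noteq> None"
    using ex_successful_choices[of S k "[]" es] assms by (auto simp: vertex_cover_def)
  obtain t :: nat where t: "t < 2 ^ k" "\<forall>i<k. bit t i = \<beta> i"
    using ex_nat_with_bits by blast
  have "vc_pass k es t = foldl (grow k \<beta>) (Some []) es"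
    using t(2) by (intro foldl_grow_cong) auto
  then show ?thesis using t(1) \<beta> by metis
qed

lemma correct_vc_answer_Some:
  "\<lbrakk>vertex_cover V E S; card S \<le> k\<rbrakk> \<Longrightarrow> correct_vc_answer V E k (Some S)"
  unfolding correct_vc_answer_def by (subst if_P) blast+

text \<open>The constant 5 is fixed here, so that one constant serves all \<open>k\<close> and
  \<open>V\<close>; the algorithm may depend on \<open>k\<close> and \<open>V\<close> but not on the
  edges.\<close>

definition solves_vc :: "nat \<Rightarrow> 'v set \<Rightarrow> ('v set, 'v set option) streaming_alg \<Rightarrow> bool" where
  "solves_vc k V A \<longleftrightarrow> (\<forall>E es. graph V E \<longrightarrow> edge_stream E es \<longrightarrow>
    (\<exists>p out. runs_to A es p out \<and> p \<le> 2 ^ k \<and> correct_vc_answer V E k out) \<and>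
    (\<forall>m\<in>memories A es. real (length m) \<le> 5 * real k * log 2 (real (card V))))"

lemma ex_vc_alg:
  fixes V :: "'v set"
  assumes "finite V" and "2 \<le> card V" and "1 \<le> k"
  shows "\<exists>A. solves_vc k V A"
proof -
  let ?X = "vc_states k V"
  obtain enc :: "nat \<times> 'v list option \<Rightarrow> memory" where inj: "inj_on enc ?X"
    and len: "\<forall>s\<in>?X. real (length (enc s)) \<le> 5 * real k * log 2 (real (card V))"
    using ex_vc_encoding[OF assms] by blast
  define dec where "dec = inv_into ?X enc"
  have dec: "\<And>s. s \<in> ?X \<Longrightarrow> dec (enc s) = s" using inj by (simp add: dec_def)
  define A where "A = encoded_alg enc dec (0, Some []) (vc_step k) (vc_finish k)"
  have "(\<exists>p out. runs_to A es p out \<and> p \<le> 2 ^ k \<and> correct_vc_answer V E k out) \<and>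
      (\<forall>m\<in>memories A es. real (length m) \<le> 5 * real k * log 2 (real (card V)))"
    if "graph V E" "edge_stream E es" for E es
  proof
    have E: "E = set es" using that by (simp add: edge_stream_def)
    have es: "\<And>e. e \<in> set es \<Longrightarrow> e \<subseteq> V \<and> card e = 2"
      using that E by (auto simp: graph_def)
    obtain p out where p: "halts_from A es (enc (0, Some [])) p out" "p \<le> 2 ^ k"
      and out: "(\<exists>u c. vc_pass k es u = Some c \<and> out = Some (set c)) \<or>
        (out = None \<and> (\<forall>u<2 ^ k. vc_pass k es u = None))"
      using halts_from_vc[where k = k and V = V and es = es and t = 0, OF dec es] unfolding A_def by auto
    have "correct_vc_answer V E k out"
      using out
    proof (elim disjE exE conjE)
      fix u c assume "vc_pass k es u = Some c" "out = Some (set c)"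
      then show ?thesis
        using vc_pass_sound[OF _ es] unfolding E by (blast intro: correct_vc_answer_Some)
    next
      assume "out = None" "\<forall>u<2 ^ k. vc_pass k es u = None"
      then show ?thesis
        using vc_pass_complete[OF assms(1)] es unfolding E correct_vc_answer_def by metis
    qed
    moreover have "runs_to A es p out"
      using p(1) by (simp add: runs_to_def A_def encoded_alg_def)
    ultimately show "\<exists>p out. runs_to A es p out \<and> p \<le> 2 ^ k \<and> correct_vc_answer V E k out"
      using p(2) by blast
    have "memories A es \<subseteq> enc ` ?X"
      unfolding A_def
    proof (rule memories_encoded_alg)
      show "(0, Some []) \<in> ?X" by (rule start_in_vc_states) simp
      show "vc_step k s e \<in> ?X" if "s \<in> ?X" "e \<in> set es" for s e
        using that es vc_step_closed by blast
    qed (use vc_finish_closed dec in auto)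
    then show "\<forall>m\<in>memories A es. real (length m) \<le> 5 * real k * log 2 (real (card V))"
      using len by blast
  qed
  then show ?thesis unfolding solves_vc_def by blast
qed

text \<open>
  For at most one vertex the bound \<open>log 2 (card V)\<close> is \<open>0\<close>, so no memory at all is available.
\<close>

lemma ex_vc_alg_trivial:
  fixes V :: "'v set"
  assumes "card V \<le> 1"
  shows "\<exists>A. solves_vc k V A"
proof -
  define A :: "('v set, 'v set option) streaming_alg" where
    "A = \<lparr>init_mem = [], on_item = \<lambda>m e. [], on_pass_end = \<lambda>m. Halt (Some {})\<rparr>"
  have "(\<exists>p out. runs_to A es p out \<and> p \<le> 2 ^ k \<and> correct_vc_answer V E k out) \<and>
      (\<forall>m\<in>memories A es. real (length m) \<le> 5 * real k * log 2 (real (card V)))"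
    if "graph V E" "edge_stream E es" for E es
  proof
    have "e \<notin> E" for e
      using that(1) assms card_mono[of V e] by (fastforce simp: graph_def)
    then have "E = {}" by blast
    then have "correct_vc_answer V E k (Some {})"
      by (intro correct_vc_answer_Some) (simp_all add: vertex_cover_def)
    moreover have "runs_to A es 1 (Some {})"
      unfolding runs_to_def by (rule halt) (simp add: A_def)
    moreover have "(1::nat) \<le> 2 ^ k" by simp
    ultimately show "\<exists>p out. runs_to A es p out \<and> p \<le> 2 ^ k \<and> correct_vc_answer V E k out"
      by blast
    have "es = []" using that(2) \<open>E = {}\<close> by (simp add: edge_stream_def)
    have "m = []" if "m \<in> pass_starts A es" for m
      using that by induction (auto simp: A_def)
    then have "m = []" if "m \<in> memories A es" for m
      using that \<open>es = []\<close> by (auto simp: memories_def scan_def)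
    \<comment> \<open>For empty \<open>V\<close> this rests on the convention
      \<open>ln 0 = 0\<close>; for a single vertex it is \<open>ln 1 = 0\<close>.\<close>
    moreover have "log 2 (real (card V)) = 0"
      using assms by (cases "card V") (auto simp: log_def)
    ultimately show "\<forall>m\<in>memories A es. real (length m) \<le> 5 * real k * log 2 (real (card V))"
      by fastforce
  qed
  then show ?thesis unfolding solves_vc_def by blast
qed

theorem theorem4:
  "\<exists>(A :: nat \<Rightarrow> 'v set \<Rightarrow> ('v set, 'v set option) streaming_alg) (C :: real).
     \<forall>k V E es. k \<ge> 1 \<longrightarrow> graph V E \<longrightarrow> edge_stream E es \<longrightarrow>
       (\<exists>p out. runs_to (A k V) es p out \<and> p \<le> 2 ^ k \<and> correct_vc_answer V E k out) \<and>
       (\<forall>m \<in> memories (A k V) es. real (length m) \<le> C * real k * log 2 (real (card V)))"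
proof -
  have "\<exists>A. solves_vc k V A" if "1 \<le> k" "finite V" for k and V :: "'v set"
    using ex_vc_alg[OF that(2) _ that(1)] ex_vc_alg_trivial[of V k] by (cases "2 \<le> card V") auto
  \<comment> \<open>Choice collects the algorithms for the separate pairs of \<open>k\<close> and
    \<open>V\<close> into one function.\<close>
  then obtain alg where
    alg: "\<And>k (V :: 'v set). 1 \<le> k \<Longrightarrow> finite V \<Longrightarrow> solves_vc k V (alg k V)"
    by metis
  show ?thesis
  proof (rule exI[of _ alg], rule exI[of _ 5], intro allI impI)
    fix k :: nat and V :: "'v set" and E es
    assume "1 \<le> k" and G: "graph V E" "edge_stream E es"
    then have "solves_vc k V (alg k V)" by (intro alg) (simp_all add: graph_def)
    then show "(\<exists>p out. runs_to (alg k V) es p out \<and> p \<le> 2 ^ k \<and> correct_vc_answer V E k out) \<and>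
        (\<forall>m \<in> memories (alg k V) es. real (length m) \<le> 5 * real k * log 2 (real (card V)))"
      unfolding solves_vc_def using G by simp
  qed
qed

end
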